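(* Let $d\in\mathbb{N}$ and let $M\in\mathcal{P}_d$, i.e. $M$ is a term for which there is a type derivation $\Pi$ of $\vdash M:\mathbf{B}$ in the system $\mathrm{STA}_{\mathbf{B}}$ with degree $\mathtt{d}(\Pi)=d$. Then $$\mathtt{space}(M)\leq 6\,|M|^{3d+3},$$ where $\mathtt{space}(M)$ is the maximal size of a configuration in the computation of the machine $\mathrm{K}_{\mathcal{B}}^{\mathcal{C}}$ with conclusion $\models M\Downarrow \mathtt{b}$ (for $\mathtt b\in\{\mathtt 0,\mathtt 1\}$).
   Context: **Terms.** $\Lambda_{\mathcal{B}}$: $M::= x\mid \mathtt{0}\mid \mathtt{1}\mid \lambda x.M\mid MM\mid \mathtt{if}\ M\ \mathtt{then}\ M\ \mathtt{else}\ M$, up to $\alpha$-equivalence; $\mathtt 0,\mathtt 1$ are the boolean constants. Size: $|x|=|\mathtt 0|=|\mathtt 1|=1$, $|\lambda x.M|=|M|+1$, $|MN|=|M|+|N|$, $|\mathtt{if}\ M\ \mathtt{then}\ N_0\ \mathtt{else}\ N_1|=|M|+|N_0|+|N_1|+1$. **Types.** Linear types $A,B::=\mathbf{B}\mid\alpha\mid\sigma\multimap A\mid\forall\alpha.A$; types $\sigma,\tau::=A\mid{!\sigma}$. A context is a finite set of assumptions $x:\sigma$ with distinct variables; $!\Gamma=\{x:{!\sigma}\mid x:\sigma\in\Gamma\}$; $\Gamma\#\Delta$ means $\mathrm{dom}(\Gamma)\cap\mathrm{dom}(\Delta)=\emptyset$; FTV = free type variables. **Rules of $\mathrm{STA}_{\mathbf{B}}$.**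 ($A,B$ linear, $\sigma,\tau$ arbitrary) - $(Ax)$: $x:A\vdash x:A$; $(\mathbf B_{\mathtt 0}I)$: $\vdash\mathtt 0:\mathbf B$; $(\mathbf B_{\mathtt 1}I)$: $\vdash\mathtt 1:\mathbf B$. - $(w)$: from $\Gamma\vdash M:\sigma$ infer $\Gamma,x:A\vdash M:\sigma$. - $(\multimap I)$: from $\Gamma,x:\sigma\vdash M:A$ infer $\Gamma\vdash\lambda x.M:\sigma\multimap A$. - $(\multimap E)$: from $\Gamma\vdash M:\sigma\multimap A$, $\Delta\vdash N:\sigma$, $\Gamma\#\Delta$ infer $\Gamma,\Delta\vdash MN:A$. - $(m)$: from $\Gamma,x_1:\sigma,\dots,x_n:\sigma\vdash M:\tau$ infer $\Gamma,x:{!\sigma}\vdash M[x/x_1,\dots,x/x_n]:\tau$. - $(sp)$: from $\Gamma\vdash M:\sigma$ infer $!\Gamma\vdash M:{!\sigma}$. - $(\forall I)$: from $\Gamma\vdash M:A$, $\alpha\notin\mathrm{FTV}(\Gamma)$ infer $\Gamma\vdash M:\forall\alpha.A$; $(\forall E)$: from $\Gamma\vdash M:\forall\alpha.B$ infer $\Gamma\vdash M:B[A/\alpha]$. - $(\mathbf BE)$: from $\Gamma\vdash M:\mathbf B$, $\Gamma\vdash N_0:A$, $\Gamma\vdash N_1:A$ infer $\Gamma\vdash\mathtt{if}\ M\ \mathtt{then}\ N_0\ \mathtt{else}\ N_1:A$. **Degree.** $\mathtt d(\Pi)$ is the maximal nesting of applications of rule $(sp)$ in $\Pi$ (0 for axioms;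 max over premises for multi-premise rules; $+1$ for $(sp)$; unchanged otherwise). **Machine $\mathrm{K}_{\mathcal{B}}^{\mathcal{C}}$.** An m-context $\mathcal A$ is a sequence of assignments $x:=M$ with distinct variables ($\varepsilon$ empty, $@$ concatenation); $|\mathcal A|$ is the sum of $|M|+1$ over its assignments. $\mathbf B$-contexts: $\mathcal C[\circ]::=\circ\mid(\mathtt{if}\ \mathcal C[\circ]\ \mathtt{then}\ M\ \mathtt{else}\ N)V_1\cdots V_n$; $\mathcal C[M]$ is the result of filling the hole $\circ$ by $M$ (and $\mathcal C[\mathcal C'[\circ]]$ similarly); $|\mathcal C|$ is the size of the term obtained by replacing $\circ$ by a variable. The machine derives statements $\mathcal C,\mathcal A\models M\Downarrow\mathtt b$, with $\mathtt b\in\{\mathtt 0,\mathtt 1\}$, by: - $(Ax)$: $\mathcal C,\mathcal A\models\mathtt b\Downarrow\mathtt b$. - $(\beta)$: from $\mathcal C,\mathcal A@\{x':=N\}\models M[x'/x]V_1\cdots V_m\Downarrow\mathtt b$ infer $\mathcal C,\mathcal A\models(\lambda x.M)NV_1\cdots V_m\Downarrow\mathtt b$, $x'$ fresh. - $(h)$: if $\{x:=N\}\in\mathcal A$, from $\mathcal C,\mathcal A\models NV_1\cdots V_m\Downarrow\mathtt b$ infer $\mathcal C,\mathcal A\models xV_1\cdots V_m\Downarrow\mathtt b$. - $(\mathtt{if}\,\mathtt i)$, $\mathtt i\in\{\mathtt 0,\mathtt 1\}$: from $\mathcal C[(\mathtt{if}\ \circ\ \mathtt{then}\ N_{\mathtt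 0}\ \mathtt{else}\ N_{\mathtt 1})V_1\cdots V_m],\mathcal A\models M\Downarrow\mathtt i$ and $\mathcal C,\mathcal A\models N_{\mathtt i}V_1\cdots V_m\Downarrow\mathtt b$ infer $\mathcal C,\mathcal A\models(\mathtt{if}\ M\ \mathtt{then}\ N_{\mathtt 0}\ \mathtt{else}\ N_{\mathtt 1})V_1\cdots V_m\Downarrow\mathtt b$. $\models M\Downarrow\mathtt b$ abbreviates $\circ,\varepsilon\models M\Downarrow\mathtt b$. Derivation trees are called computations and their nodes $\phi$ of shape $\mathcal C,\mathcal A\models N\Downarrow\mathtt b'$ configurations; the size of $\phi$ is $|\mathcal C|+|\mathcal A|+|N|$. *)

theory Defs
  imports Main "HOL-Library.Extended_Nat"
begin

section \<open>Terms\<close>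

type_synonym name = nat

datatype bit = Zero | One

text \<open>
  Terms modulo \<open>\<alpha>\<close>-equivalence, in locally nameless form: free variables are names
  (\<open>Var\<close>), bound variables are de Bruijn indices (\<open>Bnd\<close>).  Named abstraction is the
  function \<open>lam\<close> below.  A dangling index cannot occur in a typable term.
\<close>

datatype trm =
    Var name
  | Bnd nat
  | Cst bit
  | Lam trm
  | App trm trm
  | Ite trm trm trm

primrec tsize :: "trm \<Rightarrow> nat" where
  "tsize (Var x) = 1"
| "tsize (Bnd i) = 1"
| "tsize (Cst b) = 1"
| "tsize (Lam M) = tsize M + 1"
| "tsize (App M N) = tsize M + tsize N"
| "tsize (Ite M N0 N1) = tsize M + tsize N0 + tsize N1 + 1"

primrec fv :: "trm \<Rightarrow> name set" where
  "fv (Var x) = {x}"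
| "fv (Bnd i) = {}"
| "fv (Cst b) = {}"
| "fv (Lam M) = fv M"
| "fv (App M N) = fv M \<union> fv N"
| "fv (Ite M N0 N1) = fv M \<union> fv N0 \<union> fv N1"

primrec close_at :: "nat \<Rightarrow> name \<Rightarrow> trm \<Rightarrow> trm" where
  "close_at k x (Var y) = (if y = x then Bnd k else Var y)"
| "close_at k x (Bnd i) = Bnd i"
| "close_at k x (Cst b) = Cst b"
| "close_at k x (Lam M) = Lam (close_at (Suc k) x M)"
| "close_at k x (App M N) = App (close_at k x M) (close_at k x N)"
| "close_at k x (Ite M N0 N1) = Ite (close_at k x M) (close_at k x N0) (close_at k x N1)"

text \<open>The term \<open>\<lambda>x.M\<close> with a named bound variable.\<close>

definition lam :: "name \<Rightarrow> trm \<Rightarrow> trm" where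
  "lam x M = Lam (close_at 0 x M)"

text \<open>If \<open>Lam M\<close> is \<open>\<lambda>x.P\<close>, then \<open>open_at 0 x' M\<close> is \<open>P[x'/x]\<close>.\<close>

primrec open_at :: "nat \<Rightarrow> name \<Rightarrow> trm \<Rightarrow> trm" where
  "open_at k x (Var y) = Var y"
| "open_at k x (Bnd i) = (if i = k then Var x else Bnd i)"
| "open_at k x (Cst b) = Cst b"
| "open_at k x (Lam M) = Lam (open_at (Suc k) x M)"
| "open_at k x (App M N) = App (open_at k x M) (open_at k x N)"
| "open_at k x (Ite M N0 N1) = Ite (open_at k x M) (open_at k x N0) (open_at k x N1)"

text \<open>Simultaneous renaming \<open>M[x/x\<^sub>1,\<dots>,x/x\<^sub>n]\<close>, where \<open>X\<close> is the set of the \<open>x\<^sub>i\<close>.\<close>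

primrec rename :: "name set \<Rightarrow> name \<Rightarrow> trm \<Rightarrow> trm" where
  "rename X x (Var y) = Var (if y \<in> X then x else y)"
| "rename X x (Bnd i) = Bnd i"
| "rename X x (Cst b) = Cst b"
| "rename X x (Lam M) = Lam (rename X x M)"
| "rename X x (App M N) = App (rename X x M) (rename X x N)"
| "rename X x (Ite M N0 N1) = Ite (rename X x M) (rename X x N0) (rename X x N1)"

abbreviation apps :: "trm \<Rightarrow> trm list \<Rightarrow> trm" where
  "apps M Vs \<equiv> foldl App M Vs"

section \<open>Types\<close>

text \<open>Linear types \<open>lty\<close> and types \<open>ty\<close>; type variables are de Bruijn indices.\<close>

datatype lty = TBool | TVar nat | Arr ty lty | All lty
and ty = Lin lty | Bang ty

primrec lift_lty :: "nat \<Rightarrow> lty \<Rightarrow> lty" and lift_ty :: "nat \<Rightarrow> ty \<Rightarrow> ty" where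
  "lift_lty k TBool = TBool"
| "lift_lty k (TVar i) = TVar (if i < k then i else Suc i)"
| "lift_lty k (Arr s A) = Arr (lift_ty k s) (lift_lty k A)"
| "lift_lty k (All A) = All (lift_lty (Suc k) A)"
| "lift_ty k (Lin A) = Lin (lift_lty k A)"
| "lift_ty k (Bang s) = Bang (lift_ty k s)"

text \<open>\<open>subst_lty k A B\<close> replaces index \<open>k\<close> in \<open>B\<close> by \<open>A\<close> and lowers the indices above \<open>k\<close>.\<close>

primrec subst_lty :: "nat \<Rightarrow> lty \<Rightarrow> lty \<Rightarrow> lty" and subst_ty :: "nat \<Rightarrow> lty \<Rightarrow> ty \<Rightarrow> ty" where
  "subst_lty k A TBool = TBool"
| "subst_lty k A (TVar i) = (if i < k then TVar i else if i = k then A else TVar (i - 1))"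
| "subst_lty k A (Arr s B) = Arr (subst_ty k A s) (subst_lty k A B)"
| "subst_lty k A (All B) = All (subst_lty (Suc k) (lift_lty 0 A) B)"
| "subst_ty k A (Lin B) = Lin (subst_lty k A B)"
| "subst_ty k A (Bang s) = Bang (subst_ty k A s)"

section \<open>The type system\<close>

type_synonym ctx = "name \<rightharpoonup> ty"

abbreviation map_ctx :: "(ty \<Rightarrow> ty) \<Rightarrow> ctx \<Rightarrow> ctx" where
  "map_ctx f \<Gamma> \<equiv> map_option f \<circ> \<Gamma>"

text \<open>
  \<open>sta d \<Gamma> M \<sigma>\<close>: there is a derivation of \<open>\<Gamma> \<turnstile> M : \<sigma>\<close> whose degree, i.e. maximal nesting of
  rule \<open>sp\<close>, is exactly \<open>d\<close>.  Derivable contexts have finite domain.  In \<open>allI\<close>, shifting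
  the context makes index \<open>0\<close> a type variable not free in it.  In \<open>m\<close>, the premise context
  is \<open>\<Gamma>, x\<^sub>1:\<sigma>, \<dots>, x\<^sub>n:\<sigma>\<close> with \<open>X = {x\<^sub>1,\<dots>,x\<^sub>n}\<close>; the case \<open>n = 0\<close>, which is derivable
  without change of degree from \<open>w\<close> and the case \<open>n = 1\<close>, is included.
\<close>

inductive sta :: "nat \<Rightarrow> ctx \<Rightarrow> trm \<Rightarrow> ty \<Rightarrow> bool" where
  ax: "sta 0 [x \<mapsto> Lin A] (Var x) (Lin A)"
| zeroI: "sta 0 Map.empty (Cst Zero) (Lin TBool)"
| oneI: "sta 0 Map.empty (Cst One) (Lin TBool)"
| w: "sta d \<Gamma> M \<sigma> \<Longrightarrow> x \<notin> dom \<Gamma> \<Longrightarrow> sta d (\<Gamma>(x \<mapsto> Lin A)) M \<sigma>"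
| arrI: "sta d (\<Gamma>(x \<mapsto> \<sigma>)) M (Lin A) \<Longrightarrow> x \<notin> dom \<Gamma> \<Longrightarrow> sta d \<Gamma> (lam x M) (Lin (Arr \<sigma> A))"
| arrE: "sta d \<Gamma> M (Lin (Arr \<sigma> A)) \<Longrightarrow> sta e \<Delta> N \<sigma> \<Longrightarrow> dom \<Gamma> \<inter> dom \<Delta> = {}
    \<Longrightarrow> sta (max d e) (\<Gamma> ++ \<Delta>) (App M N) (Lin A)"
| m: "sta d (\<Gamma> ++ ((\<lambda>_. Some \<sigma>) |` X)) M \<tau> \<Longrightarrow> finite X \<Longrightarrow> X \<inter> dom \<Gamma> = {} \<Longrightarrow> x \<notin> dom \<Gamma>
    \<Longrightarrow> sta d (\<Gamma>(x \<mapsto> Bang \<sigma>)) (rename X x M) \<tau>"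
| sp: "sta d \<Gamma> M \<sigma> \<Longrightarrow> sta (Suc d) (map_ctx Bang \<Gamma>) M (Bang \<sigma>)"
| allI: "sta d (map_ctx (lift_ty 0) \<Gamma>) M (Lin A) \<Longrightarrow> sta d \<Gamma> M (Lin (All A))"
| allE: "sta d \<Gamma> M (Lin (All B)) \<Longrightarrow> sta d \<Gamma> M (Lin (subst_lty 0 A B))"
| boolE: "sta d \<Gamma> M (Lin TBool) \<Longrightarrow> sta d0 \<Gamma> N0 (Lin A) \<Longrightarrow> sta d1 \<Gamma> N1 (Lin A)
    \<Longrightarrow> sta (max d (max d0 d1)) \<Gamma> (Ite M N0 N1) (Lin A)"

definition programs :: "nat \<Rightarrow> trm set" where
  "programs d = {M. sta d Map.empty M (Lin TBool)}"

section \<open>The abstract machine\<close>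

type_synonym mctx = "(name \<times> trm) list"

definition msize :: "mctx \<Rightarrow> nat" where
  "msize \<A> = (\<Sum>(x, M)\<leftarrow>\<A>. tsize M + 1)"

definition mnames :: "mctx \<Rightarrow> name set" where
  "mnames \<A> = (\<Union>(x, M)\<in>set \<A>. insert x (fv M))"

text \<open>\<open>CIf C M N Vs\<close> stands for \<open>(if C[\<circ>] then M else N) V\<^sub>1 \<dots> V\<^sub>n\<close>.\<close>

datatype bctx = Hole | CIf bctx trm trm "trm list"

primrec fill :: "bctx \<Rightarrow> trm \<Rightarrow> trm" where
  "fill Hole P = P"
| "fill (CIf C M N Vs) P = apps (Ite (fill C P) M N) Vs"

primrec bcomp :: "bctx \<Rightarrow> bctx \<Rightarrow> bctx" where
  "bcomp Hole D = D"
| "bcomp (CIf C M N Vs) D = CIf (bcomp C D) M N Vs"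

primrec bnames :: "bctx \<Rightarrow> name set" where
  "bnames Hole = {}"
| "bnames (CIf C M N Vs) = bnames C \<union> fv M \<union> fv N \<union> (\<Union>V\<in>set Vs. fv V)"

text \<open>The choice of the variable filling the hole is irrelevant.\<close>

definition bsize :: "bctx \<Rightarrow> nat" where
  "bsize C = tsize (fill C (Var 0))"

text \<open>A configuration \<open>C, \<A> \<Turnstile> M \<Down> b\<close>.\<close>

datatype config = Config bctx mctx trm bit

primrec csize :: "config \<Rightarrow> nat" where
  "csize (Config C \<A> M b) = bsize C + msize \<A> + tsize M"

text \<open>
  \<open>computation C \<A> M b \<Phi>\<close>: there is a computation with conclusion \<open>C, \<A> \<Turnstile> M \<Down> b\<close>, the nodes
  of which are exactly the configurations in \<open>\<Phi>\<close>.  Following the rules of the machine, the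
  constant \<open>0\<close> selects the then-branch.
\<close>

inductive computation :: "bctx \<Rightarrow> mctx \<Rightarrow> trm \<Rightarrow> bit \<Rightarrow> config set \<Rightarrow> bool" where
  Ax: "computation C \<A> (Cst b) b {Config C \<A> (Cst b) b}"
| beta: "computation C (\<A> @ [(x', N)]) (apps (open_at 0 x' M) Vs) b \<Phi>
    \<Longrightarrow> x' \<notin> bnames C \<union> mnames \<A> \<union> fv (apps (App (Lam M) N) Vs)
    \<Longrightarrow> computation C \<A> (apps (App (Lam M) N) Vs) b
          (insert (Config C \<A> (apps (App (Lam M) N) Vs) b) \<Phi>)"
| h: "computation C \<A> (apps N Vs) b \<Phi> \<Longrightarrow> (x, N) \<in> set \<A>
    \<Longrightarrow> computation C \<A> (apps (Var x) Vs) b (insert (Config C \<A> (apps (Var x) Vs) b) \<Phi>)"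
| if0: "computation (bcomp C (CIf Hole N0 N1 Vs)) \<A> M Zero \<Phi> \<Longrightarrow> computation C \<A> (apps N0 Vs) b \<Psi>
    \<Longrightarrow> computation C \<A> (apps (Ite M N0 N1) Vs) b
          (insert (Config C \<A> (apps (Ite M N0 N1) Vs) b) (\<Phi> \<union> \<Psi>))"
| if1: "computation (bcomp C (CIf Hole N0 N1 Vs)) \<A> M One \<Phi> \<Longrightarrow> computation C \<A> (apps N1 Vs) b \<Psi>
    \<Longrightarrow> computation C \<A> (apps (Ite M N0 N1) Vs) b
          (insert (Config C \<A> (apps (Ite M N0 N1) Vs) b) (\<Phi> \<union> \<Psi>))"

text \<open>
  Computations are unique up to the choice of fresh names, on which sizes do not depend;
  the supremum over all of them is the maximum over the configurations of one.  It is taken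
  in \<open>enat\<close>, so that boundedness is not presupposed.  By convention it is \<open>0\<close> if there is no
  computation; the definition does not assert that \<open>M\<close> evaluates to a constant.
\<close>

definition space :: "trm \<Rightarrow> enat" where
  "space M = (SUP \<phi> \<in> {\<phi>. \<exists>b \<Phi>. computation Hole [] M b \<Phi> \<and> \<phi> \<in> \<Phi>}. enat (csize \<phi>))"

end

theory Submission imports Defs begin

text \<open>
  Types are interpreted by realizability: a type denotes a set of pairs of a weight and a
  term.  At type \<open>TBool\<close> the weight bounds the number of \<open>\<beta>\<close>- and
  conditional steps on every branch of the call-by-name evaluation of the term; a realizer of
  \<open>\<sigma> \<multimap> A\<close> adds its weight to that of its argument; and \<open>!\<close> multiplies
  weights by a fixed \<open>r\<close> bounding the number of occurrences contracted by any use of rule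
  \<open>m\<close>.  Polymorphism is interpreted by quantification over all weighted sets closed under head
  expansion, so that no subject reduction is needed.  A program \<open>M\<close> of degree \<open>d\<close> then has weight
  \<open>|M|\<^sup>d\<^sup>+\<^sup>1\<close>, taking \<open>r = |M|\<close>.  The weight bounds the length of the stack and the
  number of assignments and of nested conditionals in a configuration, while all terms on the
  stack and in the m-context are renamed subterms of \<open>M\<close>, of size at most \<open>|M|\<close>.
\<close>

section \<open>Substitution and spines\<close>

text \<open>The machine replaces an index by a name, call-by-name evaluation by a term. Nothing is
  shifted under \<open>Lam\<close>, which is sound for locally closed \<open>P\<close>.\<close>

primrec inst :: "nat \<Rightarrow> trm \<Rightarrow> trm \<Rightarrow> trm" where
  "inst k P (Var y) = Var y"
| "inst k P (Bnd i) = (if i = k then P else Bnd i)"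
| "inst k P (Cst b) = Cst b"
| "inst k P (Lam M) = Lam (inst (Suc k) P M)"
| "inst k P (App M N) = App (inst k P M) (inst k P N)"
| "inst k P (Ite M N0 N1) = Ite (inst k P M) (inst k P N0) (inst k P N1)"

primrec psubst :: "(name \<Rightarrow> trm) \<Rightarrow> trm \<Rightarrow> trm" where
  "psubst \<rho> (Var y) = \<rho> y"
| "psubst \<rho> (Bnd i) = Bnd i"
| "psubst \<rho> (Cst b) = Cst b"
| "psubst \<rho> (Lam M) = Lam (psubst \<rho> M)"
| "psubst \<rho> (App M N) = App (psubst \<rho> M) (psubst \<rho> N)"
| "psubst \<rho> (Ite M N0 N1) = Ite (psubst \<rho> M) (psubst \<rho> N0) (psubst \<rho> N1)"

primrec lc :: "nat \<Rightarrow> trm \<Rightarrow> bool" where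
  "lc k (Var y) = True"
| "lc k (Bnd i) = (i < k)"
| "lc k (Cst b) = True"
| "lc k (Lam M) = lc (Suc k) M"
| "lc k (App M N) = (lc k M \<and> lc k N)"
| "lc k (Ite M N0 N1) = (lc k M \<and> lc k N0 \<and> lc k N1)"

lemma lc_mono: "lc k M \<Longrightarrow> k \<le> l \<Longrightarrow> lc l M"
  by (induction M arbitrary: k l) fastforce+

lemma lc_close_at: "lc k M \<Longrightarrow> lc (Suc k) (close_at k x M)"
  by (induction M arbitrary: k) auto

lemma lc_open_at: "lc (Suc k) M \<Longrightarrow> lc k (open_at k x M)"
  by (induction M arbitrary: k) auto

lemma lc_rename: "lc k (rename X x M) = lc k M"
  by (induction M arbitrary: k) auto

lemma lc_psubst: "lc k M \<Longrightarrow> \<forall>y. lc 0 (\<rho> y) \<Longrightarrow> lc k (psubst \<rho> M)"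
  by (induction M arbitrary: k) (auto intro: lc_mono)

lemma lc_apps: "lc k (apps M Vs) \<longleftrightarrow> lc k M \<and> (\<forall>V\<in>set Vs. lc k V)"
  by (induction Vs arbitrary: M) auto

lemma inst_lc: "lc k M \<Longrightarrow> inst k P M = M"
  by (induction M arbitrary: k) auto

text \<open>The values of the environment have no dangling index, so \<open>inst\<close> reaches
  only the index left by closing \<open>x\<close>: contracting an instance of \<open>lam x M\<close>
  is an update of the environment.\<close>

lemma inst_psubst_close_at:
  assumes "lc k M" "\<forall>y. lc 0 (\<rho> y)"
  shows "inst k P (psubst \<rho> (close_at k x M)) = psubst (\<rho>(x := P)) M"
  using assms(1)
proof (induction M arbitrary: k)
  case (Var y)
  have "lc k (\<rho> y)" using assms(2) lc_mono by blast
  then show ?case by (simp add: inst_lc)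
qed auto

lemma inst_psubst_open_at:
  assumes "x \<notin> fv M" "\<forall>y. lc 0 (\<rho> y)"
  shows "inst k P (psubst \<rho> M) = psubst (\<rho>(x := P)) (open_at k x M)"
  using assms(1)
proof (induction M arbitrary: k)
  case (Var y)
  have "lc k (\<rho> y)" using assms(2) lc_mono by blast
  with Var show ?case by (simp add: inst_lc)
qed auto

lemma psubst_cong: "(\<And>y. y \<in> fv M \<Longrightarrow> \<rho> y = \<rho>' y) \<Longrightarrow> psubst \<rho> M = psubst \<rho>' M"
  by (induction M) auto

lemma psubst_rename: "psubst \<rho> (rename X x M) = psubst (\<lambda>y. if y \<in> X then \<rho> x else \<rho> y) M"
  by (induction M) auto

lemma psubst_Var: "psubst Var M = M"
  by (induction M) auto

lemma psubst_apps: "psubst \<rho> (apps M Vs) = apps (psubst \<rho> M) (map (psubst \<rho>) Vs)"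
  by (induction Vs arbitrary: M) auto

section \<open>Free variables and sizes\<close>

lemma fv_close_at: "fv (close_at k x M) = fv M - {x}"
  by (induction M arbitrary: k) auto

lemma fv_rename: "fv (rename X x M) = (fv M - X) \<union> (if fv M \<inter> X = {} then {} else {x})"
  by (induction M) auto

lemma finite_fv: "finite (fv M)"
  by (induction M) auto

lemma fv_apps: "fv (apps M Vs) = fv M \<union> (\<Union>V\<in>set Vs. fv V)"
  by (induction Vs arbitrary: M) auto

lemma tsize_pos: "1 \<le> tsize M"
  by (induction M) auto

text \<open>Ensures that an \<open>r\<close> bounding the size of a term also bounds the number of
  its variables merged by rule \<open>m\<close>.\<close>

lemma card_fv_le_tsize: "card (fv M) \<le> tsize M"
proof (induction M)
  case (App M N)
  then show ?case using card_Un_le[of "fv M" "fv N"] by simp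
next
  case (Ite M N0 N1)
  have "card (fv (Ite M N0 N1)) \<le> card (fv M) + card (fv N0) + card (fv N1)"
    using card_Un_le[of "fv M \<union> fv N0" "fv N1"] card_Un_le[of "fv M" "fv N0"] by simp
  with Ite show ?case by simp
qed auto

lemma tsize_close_at: "tsize (close_at k x M) = tsize M"
  by (induction M arbitrary: k) auto

lemma tsize_open_at: "tsize (open_at k x M) = tsize M"
  by (induction M arbitrary: k) auto

lemma tsize_rename: "tsize (rename X x M) = tsize M"
  by (induction M) auto

lemma tsize_apps: "tsize (apps M Vs) = tsize M + (\<Sum>V\<leftarrow>Vs. tsize V)"
  by (induction Vs arbitrary: M) auto

section \<open>Heads and arguments of iterated applications\<close>

primrec nargs :: "trm \<Rightarrow> nat" where
  "nargs (Var x) = 0"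
| "nargs (Bnd i) = 0"
| "nargs (Cst b) = 0"
| "nargs (Lam M) = 0"
| "nargs (App M N) = Suc (nargs M)"
| "nargs (Ite M N0 N1) = 0"

lemma nargs_apps: "nargs (apps M Vs) = nargs M + length Vs"
  by (induction Vs arbitrary: M) auto

text \<open>Only an inequality: a head variable may be replaced by an application, which brings
  further arguments.\<close>

lemma nargs_le_psubst: "nargs M \<le> nargs (psubst \<rho> M)"
  by (induction M) auto

lemma apps_inject:
  assumes "apps M Vs = apps N Us" "nargs M = 0" "nargs N = 0"
  shows "M = N \<and> Vs = Us"
  using assms
proof (induction Vs arbitrary: Us rule: rev_induct)
  case Nil
  then show ?case by (cases Us rule: rev_cases) auto
next
  case (snoc V Vs)
  show ?case
  proof (cases Us rule: rev_cases)
    case Nil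
    with snoc.prems show ?thesis by auto
  next
    case (snoc Us' U)
    with snoc.prems have "apps M Vs = apps N Us'" "V = U" by simp_all
    with snoc snoc.prems show ?thesis using snoc.IH[of Us'] by blast
  qed
qed

text \<open>\<open>spine_le n (h V\<^sub>1 \<dots> V\<^sub>m)\<close>: each of \<open>h\<close>, \<open>V\<^sub>1\<close>, \<dots>, \<open>V\<^sub>m\<close> has size at most \<open>n\<close>.\<close>

primrec spine_le :: "nat \<Rightarrow> trm \<Rightarrow> bool" where
  "spine_le n (Var x) = (1 \<le> n)"
| "spine_le n (Bnd i) = (1 \<le> n)"
| "spine_le n (Cst b) = (1 \<le> n)"
| "spine_le n (Lam M) = (tsize M + 1 \<le> n)"
| "spine_le n (App M N) = (spine_le n M \<and> tsize N \<le> n)"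
| "spine_le n (Ite M N0 N1) = (tsize M + tsize N0 + tsize N1 + 1 \<le> n)"

lemma spine_le_apps: "spine_le n (apps M Vs) \<longleftrightarrow> spine_le n M \<and> (\<forall>V\<in>set Vs. tsize V \<le> n)"
  by (induction Vs arbitrary: M) auto

lemma spine_le_if_tsize_le: "tsize M \<le> n \<Longrightarrow> spine_le n M"
  by (induction M) auto

lemma tsize_le_if_spine_le: "spine_le n M \<Longrightarrow> tsize M \<le> n * (1 + nargs M)"
  by (induction M) auto

section \<open>Weighted evaluation\<close>

text \<open>Besides the number of steps, the weight also bounds the number of arguments of every term
  reached; this costs nothing, since each argument is consumed by a later step.\<close>

inductive bnd :: "nat \<Rightarrow> trm \<Rightarrow> bool" where
  bndI: "nargs T \<le> p
    \<Longrightarrow> (\<And>M N Vs. T = apps (Lam M) (N # Vs) \<Longrightarrow> \<exists>q. p = Suc q \<and> bnd q (apps (inst 0 N M) Vs))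
    \<Longrightarrow> (\<And>M N0 N1 Vs. T = apps (Ite M N0 N1) Vs
          \<Longrightarrow> \<exists>q. p = Suc q \<and> bnd q M \<and> bnd q (apps N0 Vs) \<and> bnd q (apps N1 Vs))
    \<Longrightarrow> bnd p T"

lemma bnd_nargs: "bnd p T \<Longrightarrow> nargs T \<le> p"
  by (auto elim: bnd.cases)

lemma bnd_beta: "bnd p (apps (Lam M) (N # Vs)) \<Longrightarrow> \<exists>q. p = Suc q \<and> bnd q (apps (inst 0 N M) Vs)"
  by (erule bnd.cases) blast

lemma bnd_Ite:
  "bnd p (apps (Ite M N0 N1) Vs)
    \<Longrightarrow> \<exists>q. p = Suc q \<and> bnd q M \<and> bnd q (apps N0 Vs) \<and> bnd q (apps N1 Vs)"
  by (erule bnd.cases) blast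

lemma bnd_mono: "bnd p T \<Longrightarrow> p \<le> p' \<Longrightarrow> bnd p' T"
proof (induction p T arbitrary: p' rule: bnd.induct)
  case (bndI T p)
  show ?case
  proof (rule bnd.bndI)
    show "nargs T \<le> p'" using bndI by simp
  next
    fix M N Vs assume "T = apps (Lam M) (N # Vs)"
    with bndI.IH(1)[OF this] bndI.prems
    show "\<exists>q. p' = Suc q \<and> bnd q (apps (inst 0 N M) Vs)"
      by (metis Suc_le_D Suc_le_mono)
  next
    fix M N0 N1 Vs assume "T = apps (Ite M N0 N1) Vs"
    with bndI.IH(2)[OF this] bndI.prems
    show "\<exists>q. p' = Suc q \<and> bnd q M \<and> bnd q (apps N0 Vs) \<and> bnd q (apps N1 Vs)"
      by (metis Suc_le_D Suc_le_mono)
  qed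
qed

text \<open>The guard is measured by \<open>bnd\<close> because its type is always
  \<open>TBool\<close>. Guard and branches share one weight instead of adding theirs, matching the
  shared context of rule \<open>boolE\<close>.\<close>

definition candidate :: "(nat \<Rightarrow> trm \<Rightarrow> bool) \<Rightarrow> bool" where
  "candidate X \<longleftrightarrow>
    (\<forall>p p' T. X p T \<longrightarrow> p \<le> p' \<longrightarrow> X p' T) \<and>
    (\<forall>p M N Vs. X p (apps (inst 0 N M) Vs) \<longrightarrow> X (Suc p) (apps (Lam M) (N # Vs))) \<and>
    (\<forall>p M N0 N1 Vs. bnd p M \<longrightarrow> X p (apps N0 Vs) \<longrightarrow> X p (apps N1 Vs)
      \<longrightarrow> X (Suc p) (apps (Ite M N0 N1) Vs))"

lemma candidateI:
  assumes "\<And>p p' T. X p T \<Longrightarrow> p \<le> p' \<Longrightarrow> X p' T"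
    and "\<And>p M N Vs. X p (apps (inst 0 N M) Vs) \<Longrightarrow> X (Suc p) (apps (Lam M) (N # Vs))"
    and "\<And>p M N0 N1 Vs. bnd p M \<Longrightarrow> X p (apps N0 Vs) \<Longrightarrow> X p (apps N1 Vs)
      \<Longrightarrow> X (Suc p) (apps (Ite M N0 N1) Vs)"
  shows "candidate X"
  using assms unfolding candidate_def by blast

lemma candidate_mono: "candidate X \<Longrightarrow> X p T \<Longrightarrow> p \<le> p' \<Longrightarrow> X p' T"
  unfolding candidate_def by blast

lemma candidate_beta:
  "candidate X \<Longrightarrow> X p (apps (inst 0 N M) Vs) \<Longrightarrow> X (Suc p) (apps (Lam M) (N # Vs))"
  unfolding candidate_def by blast

lemma candidate_Ite:
  "candidate X \<Longrightarrow> bnd p M \<Longrightarrow> X p (apps N0 Vs) \<Longrightarrow> X p (apps N1 Vs)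
    \<Longrightarrow> X (Suc p) (apps (Ite M N0 N1) Vs)"
  unfolding candidate_def by blast

lemma candidate_bnd: "candidate bnd"
proof (rule candidateI)
  show "bnd p T \<Longrightarrow> p \<le> p' \<Longrightarrow> bnd p' T" for p p' T by (rule bnd_mono)
next
  fix p M N Vs assume *: "bnd p (apps (inst 0 N M) Vs)"
  show "bnd (Suc p) (apps (Lam M) (N # Vs))"
  proof (rule bndI)
    \<comment> \<open>The contractum has at least \<open>length Vs\<close> arguments; the extra step
      pays for \<open>N\<close>.\<close>
    show "nargs (apps (Lam M) (N # Vs)) \<le> Suc p"
      using bnd_nargs[OF *] by (simp add: nargs_apps)
  next
    fix M' N' Vs' assume "apps (Lam M) (N # Vs) = apps (Lam M') (N' # Vs')"
    from apps_inject[OF this] *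
    show "\<exists>q. Suc p = Suc q \<and> bnd q (apps (inst 0 N' M') Vs')" by simp
  next
    fix M' N0 N1 Vs' assume "apps (Lam M) (N # Vs) = apps (Ite M' N0 N1) Vs'"
    from apps_inject[OF this]
    show "\<exists>q. Suc p = Suc q \<and> bnd q M' \<and> bnd q (apps N0 Vs') \<and> bnd q (apps N1 Vs')" by simp
  qed
next
  fix p M N0 N1 Vs assume *: "bnd p M" "bnd p (apps N0 Vs)" "bnd p (apps N1 Vs)"
  show "bnd (Suc p) (apps (Ite M N0 N1) Vs)"
  proof (rule bndI)
    show "nargs (apps (Ite M N0 N1) Vs) \<le> Suc p"
      using bnd_nargs[OF *(2)] by (simp add: nargs_apps)
  next
    fix M' N' Vs' assume "apps (Ite M N0 N1) Vs = apps (Lam M') (N' # Vs')"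
    from apps_inject[OF this]
    show "\<exists>q. Suc p = Suc q \<and> bnd q (apps (inst 0 N' M') Vs')" by simp
  next
    fix M' N0' N1' Vs' assume "apps (Ite M N0 N1) Vs = apps (Ite M' N0' N1') Vs'"
    from apps_inject[OF this] *
    show "\<exists>q. Suc p = Suc q \<and> bnd q M' \<and> bnd q (apps N0' Vs') \<and> bnd q (apps N1' Vs')" by simp
  qed
qed

lemma bnd_Cst: "bnd p (Cst b)"
proof (rule bndI)
  show "nargs (Cst b) \<le> p" by simp
next
  fix M N Vs assume "Cst b = apps (Lam M) (N # Vs)"
  from arg_cong[OF this, of nargs] show "\<exists>q. p = Suc q \<and> bnd q (apps (inst 0 N M) Vs)"
    by (simp add: nargs_apps)
next
  fix M N0 N1 Vs assume "Cst b = apps (Ite M N0 N1) Vs"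
  then have "apps (Cst b) [] = apps (Ite M N0 N1) Vs" by simp
  from apps_inject[OF this]
  show "\<exists>q. p = Suc q \<and> bnd q M \<and> bnd q (apps N0 Vs) \<and> bnd q (apps N1 Vs)" by simp
qed

section \<open>Interpretation of types\<close>

text \<open>Arguments are locally closed so that they may become values of an environment. In the
  clause for \<open>Bang\<close>, an inequality in place of an equation keeps the meaning closed
  under larger weights.\<close>

primrec sem_lty :: "nat \<Rightarrow> lty \<Rightarrow> (nat \<Rightarrow> nat \<Rightarrow> trm \<Rightarrow> bool) \<Rightarrow> nat \<Rightarrow> trm \<Rightarrow> bool"
  and sem_ty :: "nat \<Rightarrow> ty \<Rightarrow> (nat \<Rightarrow> nat \<Rightarrow> trm \<Rightarrow> bool) \<Rightarrow> nat \<Rightarrow> trm \<Rightarrow> bool" where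
  "sem_lty r TBool = (\<lambda>\<eta>. bnd)"
| "sem_lty r (TVar i) = (\<lambda>\<eta>. \<eta> i)"
| "sem_lty r (Arr s A) = (\<lambda>\<eta> p T.
    \<forall>q N. lc 0 N \<longrightarrow> sem_ty r s \<eta> q N \<longrightarrow> sem_lty r A \<eta> (p + q) (App T N))"
| "sem_lty r (All A) = (\<lambda>\<eta> p T. \<forall>X. candidate X \<longrightarrow> sem_lty r A (case_nat X \<eta>) p T)"
| "sem_ty r (Lin A) = sem_lty r A"
| "sem_ty r (Bang s) = (\<lambda>\<eta> p T. \<exists>q. r * q \<le> p \<and> sem_ty r s \<eta> q T)"

lemma candidate_case_nat:
  "candidate X \<Longrightarrow> \<forall>i. candidate (\<eta> i) \<Longrightarrow> \<forall>i. candidate (case_nat X \<eta> i)"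
  by (auto split: nat.split)

text \<open>At an arrow type the new argument goes to the end of the spine, so the head step is
  unchanged. Only linear types are covered: under \<open>Bang\<close> a head step would cost
  \<open>r\<close> instead of 1.\<close>

lemma candidate_sem_lty: "\<forall>i. candidate (\<eta> i) \<Longrightarrow> candidate (sem_lty r A \<eta>)"
proof (induction A arbitrary: \<eta> rule: lty.induct[where ?P2.0 = "\<lambda>_. True"])
  case TBool
  then show ?case by (simp add: candidate_bnd)
next
  case (TVar i)
  then show ?case by simp
next
  case (Arr s A)
  have A: "candidate (sem_lty r A \<eta>)" using Arr by blast
  show ?case
  proof (rule candidateI)
    fix p p' T assume *: "sem_lty r (Arr s A) \<eta> p T" "p \<le> p'"
    have "sem_lty r A \<eta> (p' + q) (App T N)" if "sem_lty r A \<eta> (p + q) (App T N)" for q N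
      using candidate_mono[OF A that] *(2) by simp
    with *(1) show "sem_lty r (Arr s A) \<eta> p' T" by simp
  next
    fix p M N Vs assume *: "sem_lty r (Arr s A) \<eta> p (apps (inst 0 N M) Vs)"
    show "sem_lty r (Arr s A) \<eta> (Suc p) (apps (Lam M) (N # Vs))"
      using * candidate_beta[OF A, of _ N M "Vs @ [_]"] by simp
  next
    fix p M N0 N1 Vs
    assume *: "bnd p M" "sem_lty r (Arr s A) \<eta> p (apps N0 Vs)" "sem_lty r (Arr s A) \<eta> p (apps N1 Vs)"
    show "sem_lty r (Arr s A) \<eta> (Suc p) (apps (Ite M N0 N1) Vs)"
      using * bnd_mono[OF *(1)] candidate_Ite[OF A, of _ M N0 "Vs @ [_]" N1] by simp
  qed
next
  case (All A)
  have A: "candidate (sem_lty r A (case_nat X \<eta>))" if "candidate X" for X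
    using All.IH[OF candidate_case_nat[OF that All.prems]] .
  show ?case
  proof (rule candidateI)
    fix p p' T assume "sem_lty r (All A) \<eta> p T" "p \<le> p'"
    then show "sem_lty r (All A) \<eta> p' T"
      by (auto intro: candidate_mono[OF A])
  next
    fix p M N Vs assume "sem_lty r (All A) \<eta> p (apps (inst 0 N M) Vs)"
    then show "sem_lty r (All A) \<eta> (Suc p) (apps (Lam M) (N # Vs))"
      using candidate_beta[OF A] by simp
  next
    fix p M N0 N1 Vs
    assume "bnd p M" "sem_lty r (All A) \<eta> p (apps N0 Vs)" "sem_lty r (All A) \<eta> p (apps N1 Vs)"
    then show "sem_lty r (All A) \<eta> (Suc p) (apps (Ite M N0 N1) Vs)"
      using candidate_Ite[OF A] by simp
  qed
qed auto

lemma sem_ty_mono: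
  "\<forall>i. candidate (\<eta> i) \<Longrightarrow> sem_ty r s \<eta> p T \<Longrightarrow> p \<le> p' \<Longrightarrow> sem_ty r s \<eta> p' T"
  by (cases s) (auto intro: candidate_mono[OF candidate_sem_lty] order_trans)

lemma sem_lift:
  "sem_lty r (lift_lty k A) \<eta> = sem_lty r A (\<lambda>i. \<eta> (if i < k then i else Suc i))"
  "sem_ty r (lift_ty k s) \<eta> = sem_ty r s (\<lambda>i. \<eta> (if i < k then i else Suc i))"
proof (induction A and s arbitrary: k \<eta> and k \<eta>)
  case (All A)
  have "(\<lambda>i. case_nat X \<eta> (if i < Suc k then i else Suc i))
      = case_nat X (\<lambda>i. \<eta> (if i < k then i else Suc i))" for X
    by (auto simp: fun_eq_iff split: nat.split)
  with All show ?case by simp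
qed (auto simp: fun_eq_iff)

lemma sem_subst:
  "sem_lty r (subst_lty k A B) \<eta>
    = sem_lty r B (\<lambda>i. if i < k then \<eta> i else if i = k then sem_lty r A \<eta> else \<eta> (i - 1))"
  "sem_ty r (subst_ty k A s) \<eta>
    = sem_ty r s (\<lambda>i. if i < k then \<eta> i else if i = k then sem_lty r A \<eta> else \<eta> (i - 1))"
proof (induction B and s arbitrary: k A \<eta> and k A \<eta>)
  case (All B)
  have "(\<lambda>i. if i < Suc k then case_nat X \<eta> i else if i = Suc k then sem_lty r A \<eta>
        else case_nat X \<eta> (i - 1))
      = case_nat X (\<lambda>i. if i < k then \<eta> i else if i = k then sem_lty r A \<eta> else \<eta> (i - 1))" for X
    by (auto simp: fun_eq_iff split: nat.split)
  \<comment> \<open>Under the quantifier \<open>A\<close> occurs lifted; \<open>sem_lift\<close>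
    drops the newly pushed candidate again.\<close>
  with All show ?case by (simp add: sem_lift cong: if_cong)
qed (auto simp: fun_eq_iff)

lemma lc_if_sta: "sta d \<Gamma> M \<sigma> \<Longrightarrow> lc 0 M"
  by (induction rule: sta.induct) (auto simp: lam_def lc_close_at lc_rename)

section \<open>Soundness of the interpretation\<close>

text \<open>Weights of the context are summed over the variables occurring in \<open>M\<close> only: rule \<open>m\<close> may
  contract arbitrarily many variables introduced by weakening.\<close>

lemma sem_if_sta:
  assumes "sta d \<Gamma> M \<sigma>" "tsize M \<le> r" "\<forall>i. candidate (\<eta> i)" "\<forall>y. lc 0 (\<rho> y)"
    and "\<And>x s. \<Gamma> x = Some s \<Longrightarrow> sem_ty r s \<eta> (q x) (\<rho> x)"
  shows "sem_ty r \<sigma> \<eta> (r ^ d * tsize M + (\<Sum>x\<in>dom \<Gamma> \<inter> fv M. q x)) (psubst \<rho> M)"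
  using assms
proof (induction arbitrary: \<eta> \<rho> q rule: sta.induct)
  case (ax x A)
  have "sem_ty r (Lin A) \<eta> (q x) (\<rho> x)" by (rule ax.prems(4)) simp
  moreover have "dom [x \<mapsto> Lin A] \<inter> fv (Var x) = {x}" by auto
  ultimately show ?case
    using sem_ty_mono[OF ax.prems(2), of r "Lin A" "q x" "\<rho> x" "Suc (q x)"]
    by (simp del: fun_upd_apply dom_fun_upd)
next
  case zeroI
  show ?case by (simp add: bnd_Cst)
next
  case oneI
  show ?case by (simp add: bnd_Cst)
next
  case (w d \<Gamma> M \<sigma> x A)
  have "sem_ty r \<sigma> \<eta> (r ^ d * tsize M + (\<Sum>x\<in>dom \<Gamma> \<inter> fv M. q x)) (psubst \<rho> M)"
    using w.hyps(2) w.prems(1-3) by (intro w.IH w.prems(4)) auto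
  moreover have "(\<Sum>x\<in>dom \<Gamma> \<inter> fv M. q x) \<le> (\<Sum>y\<in>dom (\<Gamma>(x \<mapsto> Lin A)) \<inter> fv M. q y)"
    by (intro sum_mono2) (auto simp: finite_fv)
  ultimately show ?case by (elim sem_ty_mono[OF w.prems(2)]) (rule add_left_mono)
next
  case (arrI d \<Gamma> x \<sigma> M A)
  have r: "1 \<le> r" using arrI.prems(1) by (simp add: lam_def)
  have sz: "tsize M \<le> r" using arrI.prems(1) by (simp add: lam_def tsize_close_at)
  have lcM: "lc 0 M" using lc_if_sta[OF arrI.hyps(1)] .
  let ?S = "\<Sum>y\<in>dom \<Gamma> \<inter> fv (lam x M). q y"
  have "sem_lty r A \<eta> (r ^ d * tsize (lam x M) + ?S + p) (App (psubst \<rho> (lam x M)) N)"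
    if N: "lc 0 N" "sem_ty r \<sigma> \<eta> p N" for p N
  proof -
    let ?q = "q(x := p)"
    have "sem_ty r (Lin A) \<eta> (r ^ d * tsize M + (\<Sum>y\<in>dom (\<Gamma>(x \<mapsto> \<sigma>)) \<inter> fv M. ?q y))
        (psubst (\<rho>(x := N)) M)"
      using arrI.prems(2,3) sz N arrI.hyps(2)
      by (intro arrI.IH) (auto intro!: arrI.prems(4) split: if_splits)
    moreover have "(\<Sum>y\<in>dom (\<Gamma>(x \<mapsto> \<sigma>)) \<inter> fv M. ?q y) \<le> p + ?S"
    proof -
      have "(\<Sum>y\<in>dom (\<Gamma>(x \<mapsto> \<sigma>)) \<inter> fv M. ?q y) \<le> (\<Sum>y\<in>insert x (dom \<Gamma> \<inter> fv (lam x M)). ?q y)"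
        by (intro sum_mono2) (auto simp: finite_fv lam_def fv_close_at)
      also have "\<dots> = p + (\<Sum>y\<in>dom \<Gamma> \<inter> fv (lam x M). ?q y)"
        using arrI.hyps(2) by (simp add: finite_fv)
      also have "(\<Sum>y\<in>dom \<Gamma> \<inter> fv (lam x M). ?q y) = ?S"
        using arrI.hyps(2) by (intro sum.cong) auto
      finally show ?thesis .
    qed
    ultimately have "sem_lty r A \<eta> (r ^ d * tsize M + (p + ?S)) (psubst (\<rho>(x := N)) M)"
      using candidate_mono[OF candidate_sem_lty[OF arrI.prems(2)]] by simp
    then have "sem_lty r A \<eta> (r ^ d * tsize M + (p + ?S))
        (apps (inst 0 N (psubst \<rho> (close_at 0 x M))) [])"
      using inst_psubst_close_at[OF lcM arrI.prems(3)] by simp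
    from candidate_beta[OF candidate_sem_lty[OF arrI.prems(2)] this]
    have *: "sem_lty r A \<eta> (Suc (r ^ d * tsize M + (p + ?S))) (App (psubst \<rho> (lam x M)) N)"
      by (simp add: lam_def)
    \<comment> \<open>The abstraction is larger than its body by one; this surplus of
      \<open>r ^ d\<close> pays for the \<open>\<beta>\<close>-step.\<close>
    have "1 \<le> r ^ d" using r by simp
    then have "Suc (r ^ d * tsize M + (p + ?S)) \<le> r ^ d * tsize (lam x M) + ?S + p"
      by (simp add: lam_def tsize_close_at)
    from candidate_mono[OF candidate_sem_lty[OF arrI.prems(2)] * this] show ?thesis .
  qed
  then show ?case by simp
next
  case (arrE d \<Gamma> M \<sigma> A e \<Delta> N)
  have r: "1 \<le> r" using arrE.prems(1) tsize_pos[of "App M N"] by linarith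
  let ?SM = "\<Sum>y\<in>dom \<Gamma> \<inter> fv M. q y" and ?SN = "\<Sum>y\<in>dom \<Delta> \<inter> fv N. q y"
  have left: "(\<Gamma> ++ \<Delta>) x = \<Gamma> x" if "\<Gamma> x = Some s" for x s
    using that arrE.hyps(3) by (metis disjoint_iff domI map_add_dom_app_simps(3))
  have M: "sem_ty r (Lin (Arr \<sigma> A)) \<eta> (r ^ d * tsize M + ?SM) (psubst \<rho> M)"
    using arrE.prems(1-3) left by (intro arrE.IH(1)) (auto intro!: arrE.prems(4))
  have N: "sem_ty r \<sigma> \<eta> (r ^ e * tsize N + ?SN) (psubst \<rho> N)"
    using arrE.prems(1-3) by (intro arrE.IH(2)) (auto intro!: arrE.prems(4))
  have "lc 0 (psubst \<rho> N)"
    using lc_if_sta[OF arrE.hyps(2)] arrE.prems(3) by (rule lc_psubst)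
  with M N have *: "sem_lty r A \<eta> (r ^ d * tsize M + ?SM + (r ^ e * tsize N + ?SN))
      (psubst \<rho> (App M N))"
    by simp
  \<comment> \<open>The contexts of function and argument are disjoint, so no variable is counted
    twice.\<close>
  have "?SM + ?SN = (\<Sum>y\<in>(dom \<Gamma> \<inter> fv M) \<union> (dom \<Delta> \<inter> fv N). q y)"
    using arrE.hyps(3) by (intro sum.union_disjoint[symmetric]) (auto simp: finite_fv)
  also have "\<dots> \<le> (\<Sum>y\<in>dom (\<Gamma> ++ \<Delta>) \<inter> fv (App M N). q y)"
    by (intro sum_mono2) (auto simp: finite_fv)
  finally have S: "?SM + ?SN \<le> (\<Sum>y\<in>dom (\<Gamma> ++ \<Delta>) \<inter> fv (App M N). q y)" .
  have "r ^ d * tsize M \<le> r ^ max d e * tsize M" "r ^ e * tsize N \<le> r ^ max d e * tsize N"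
    using r by (auto intro!: mult_right_mono power_increasing)
  with S have "r ^ d * tsize M + ?SM + (r ^ e * tsize N + ?SN)
      \<le> r ^ max d e * tsize (App M N) + (\<Sum>y\<in>dom (\<Gamma> ++ \<Delta>) \<inter> fv (App M N). q y)"
    unfolding tsize.simps distrib_left by linarith
  from candidate_mono[OF candidate_sem_lty[OF arrE.prems(2)] * this] show ?case by simp
next
  case (m d \<Gamma> \<sigma> X M \<tau> x)
  \<comment> \<open>All merged variables receive the value of \<open>x\<close>, each with the weight
    \<open>p\<close> found under the \<open>Bang\<close>.\<close>
  obtain p where p: "r * p \<le> q x" "sem_ty r \<sigma> \<eta> p (\<rho> x)"
    using m.prems(4)[of x "Bang \<sigma>"] by auto
  let ?\<Gamma> = "\<Gamma> ++ ((\<lambda>_. Some \<sigma>) |` X)"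
  let ?q = "\<lambda>y. if y \<in> X then p else q y"
  let ?\<rho> = "\<lambda>y. if y \<in> X then \<rho> x else \<rho> y"
  have sz: "tsize M \<le> r" using m.prems(1) by (simp add: tsize_rename)
  have "sem_ty r \<tau> \<eta> (r ^ d * tsize M + (\<Sum>y\<in>dom ?\<Gamma> \<inter> fv M. ?q y)) (psubst ?\<rho> M)"
  proof (rule m.IH)
    fix y s assume y: "?\<Gamma> y = Some s"
    show "sem_ty r s \<eta> (?q y) (?\<rho> y)"
    proof (cases "y \<in> X")
      case True
      with y p show ?thesis by (simp add: map_add_def)
    next
      case False
      with y have "\<Gamma> y = Some s" by (simp add: map_add_def)
      with m.hyps(4) have "(\<Gamma>(x \<mapsto> Bang \<sigma>)) y = Some s" by auto
      with False m.prems(4) show ?thesis by simp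
    qed
  qed (use sz m.prems in auto)
  moreover have "(\<Sum>y\<in>dom ?\<Gamma> \<inter> fv M. ?q y) \<le> (\<Sum>y\<in>dom (\<Gamma>(x \<mapsto> Bang \<sigma>)) \<inter> fv (rename X x M). q y)"
  proof -
    have "dom ?\<Gamma> \<inter> fv M = (X \<inter> fv M) \<union> (dom \<Gamma> \<inter> fv M)" by auto
    then have "(\<Sum>y\<in>dom ?\<Gamma> \<inter> fv M. ?q y) = (\<Sum>y\<in>X \<inter> fv M. ?q y) + (\<Sum>y\<in>dom \<Gamma> \<inter> fv M. ?q y)"
      using m.hyps(3) by (simp only:) (intro sum.union_disjoint, auto simp: finite_fv)
    also have "(\<Sum>y\<in>X \<inter> fv M. ?q y) = card (X \<inter> fv M) * p" by simp
    also have "(\<Sum>y\<in>dom \<Gamma> \<inter> fv M. ?q y) = (\<Sum>y\<in>dom \<Gamma> \<inter> fv M. q y)"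
      using m.hyps(3) by (intro sum.cong) auto
    also have "card (X \<inter> fv M) * p \<le> (\<Sum>y\<in>{x} \<inter> fv (rename X x M). q y)"
    proof (cases "X \<inter> fv M = {}")
      case False
      \<comment> \<open>At most \<open>r\<close> merged variables occur in \<open>M\<close>, so
        together they weigh at most \<open>r * p\<close>, hence at most \<open>q x\<close>.\<close>
      have "card (X \<inter> fv M) \<le> card (fv M)" by (intro card_mono) (auto simp: finite_fv)
      also have "\<dots> \<le> r" using card_fv_le_tsize[of M] sz by linarith
      finally have "card (X \<inter> fv M) * p \<le> q x" using p(1) by (meson mult_le_mono1 order_trans)
      moreover have "{x} \<inter> fv (rename X x M) = {x}" using False by (auto simp: fv_rename)
      ultimately show ?thesis by simp
    qed simp
    also have "(\<Sum>y\<in>{x} \<inter> fv (rename X x M). q y) + (\<Sum>y\<in>dom \<Gamma> \<inter> fv M. q y)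
        = (\<Sum>y\<in>({x} \<inter> fv (rename X x M)) \<union> (dom \<Gamma> \<inter> fv M). q y)"
      using m.hyps(4) by (intro sum.union_disjoint[symmetric]) (auto simp: finite_fv)
    also have "\<dots> \<le> (\<Sum>y\<in>dom (\<Gamma>(x \<mapsto> Bang \<sigma>)) \<inter> fv (rename X x M). q y)"
      using m.hyps(3) by (intro sum_mono2) (auto simp: finite_fv fv_rename)
    finally show ?thesis by simp
  qed
  ultimately show ?case
    unfolding psubst_rename tsize_rename
    by (elim sem_ty_mono[OF m.prems(2)]) (rule add_left_mono)
next
  case (sp d \<Gamma> M \<sigma>)
  have "\<exists>p. \<Gamma> x = Some s \<longrightarrow> r * p \<le> q x \<and> sem_ty r s \<eta> p (\<rho> x)" for x s
    using sp.prems(4)[of x "Bang s"] by auto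
  \<comment> \<open>The type \<open>s\<close> is determined by \<open>x\<close>, so \<open>p\<close>
    can be chosen depending on \<open>x\<close> alone.\<close>
  then have "\<forall>x. \<exists>p. \<forall>s. \<Gamma> x = Some s \<longrightarrow> r * p \<le> q x \<and> sem_ty r s \<eta> p (\<rho> x)"
    by (metis option.inject)
  then obtain p where p: "\<And>x s. \<Gamma> x = Some s \<Longrightarrow> r * p x \<le> q x \<and> sem_ty r s \<eta> (p x) (\<rho> x)"
    by metis
  have "sem_ty r \<sigma> \<eta> (r ^ d * tsize M + (\<Sum>x\<in>dom \<Gamma> \<inter> fv M. p x)) (psubst \<rho> M)"
    using sp.prems(1-3) p by (intro sp.IH) auto
  moreover have "r * (r ^ d * tsize M + (\<Sum>x\<in>dom \<Gamma> \<inter> fv M. p x))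
      \<le> r ^ Suc d * tsize M + (\<Sum>x\<in>dom \<Gamma> \<inter> fv M. q x)"
    unfolding distrib_left sum_distrib_left power_Suc mult.assoc
    using p by (intro add_left_mono sum_mono) auto
  moreover have "dom (map_ctx Bang \<Gamma>) = dom \<Gamma>" by auto
  ultimately show ?case by (simp only: sem_ty.simps) blast
next
  case (allI d \<Gamma> M A)
  have dom: "dom (map_ctx (lift_ty 0) \<Gamma>) = dom \<Gamma>" by auto
  have "sem_ty r (Lin A) (case_nat X \<eta>)
      (r ^ d * tsize M + (\<Sum>x\<in>dom (map_ctx (lift_ty 0) \<Gamma>) \<inter> fv M. q x)) (psubst \<rho> M)"
    if "candidate X" for X
  proof (rule allI.IH)
    show "\<forall>i. candidate (case_nat X \<eta> i)" using candidate_case_nat[OF that allI.prems(2)] .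
    fix x s assume "map_ctx (lift_ty 0) \<Gamma> x = Some s"
    then obtain t where t: "\<Gamma> x = Some t" "s = lift_ty 0 t" by auto
    with allI.prems(4)[OF t(1)] show "sem_ty r s (case_nat X \<eta>) (q x) (\<rho> x)"
      by (simp add: sem_lift)
  qed (use allI.prems in auto)
  then show ?case by (simp add: dom)
next
  case (allE d \<Gamma> M B A)
  have env: "(\<lambda>i. if i < 0 then \<eta> i else if i = 0 then sem_lty r A \<eta> else \<eta> (i - 1))
      = case_nat (sem_lty r A \<eta>) \<eta>"
    by (auto simp: fun_eq_iff split: nat.split)
  have "sem_ty r (Lin (All B)) \<eta> (r ^ d * tsize M + (\<Sum>x\<in>dom \<Gamma> \<inter> fv M. q x)) (psubst \<rho> M)"
    by (rule allE.IH) (use allE.prems in auto)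
  \<comment> \<open>The quantifier is instantiated with the meaning of \<open>A\<close>, itself a
    candidate.\<close>
  then show ?case
    using candidate_sem_lty[OF allE.prems(2), of r A] by (simp only: sem_ty.simps sem_lty.simps sem_subst env)
next
  case (boolE d \<Gamma> M d0 N0 A d1 N1)
  have r: "1 \<le> r" using boolE.prems(1) by simp
  let ?d = "max d (max d0 d1)"
  let ?S = "\<Sum>x\<in>dom \<Gamma> \<inter> fv (Ite M N0 N1). q x"
  \<comment> \<open>The \<open>+ 1\<close> in the size of the conditional is left out here; the
    resulting gap of \<open>r ^ ?d\<close> pays for the conditional step.\<close>
  let ?p = "r ^ ?d * (tsize M + tsize N0 + tsize N1) + ?S"
  have le: "r ^ e * tsize P + (\<Sum>x\<in>dom \<Gamma> \<inter> fv P. q x) \<le> ?p"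
    if "e \<le> ?d" "fv P \<subseteq> fv (Ite M N0 N1)" "tsize P \<le> tsize M + tsize N0 + tsize N1" for e P
    using that r by (intro add_mono mult_mono power_increasing sum_mono2) (auto simp: finite_fv)
  have "sem_ty r (Lin TBool) \<eta> (r ^ d * tsize M + (\<Sum>x\<in>dom \<Gamma> \<inter> fv M. q x)) (psubst \<rho> M)"
    by (rule boolE.IH(1)) (use boolE.prems in auto)
  then have M: "bnd ?p (psubst \<rho> M)"
    using bnd_mono[OF _ le[of d M]] by (auto simp: le_max_iff_disj)
  have cand: "candidate (sem_lty r A \<eta>)" using candidate_sem_lty[OF boolE.prems(2)] .
  have "sem_ty r (Lin A) \<eta> (r ^ d0 * tsize N0 + (\<Sum>x\<in>dom \<Gamma> \<inter> fv N0. q x)) (psubst \<rho> N0)"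
    by (rule boolE.IH(2)) (use boolE.prems in auto)
  then have N0: "sem_lty r A \<eta> ?p (psubst \<rho> N0)"
    using candidate_mono[OF cand _ le[of d0 N0]] by (auto simp: le_max_iff_disj)
  have "sem_ty r (Lin A) \<eta> (r ^ d1 * tsize N1 + (\<Sum>x\<in>dom \<Gamma> \<inter> fv N1. q x)) (psubst \<rho> N1)"
    by (rule boolE.IH(3)) (use boolE.prems in auto)
  then have N1: "sem_lty r A \<eta> ?p (psubst \<rho> N1)"
    using candidate_mono[OF cand _ le[of d1 N1]] by (auto simp: le_max_iff_disj)
  have *: "sem_lty r A \<eta> (Suc ?p) (psubst \<rho> (Ite M N0 N1))"
    using candidate_Ite[OF cand M, of "psubst \<rho> N0" "[]" "psubst \<rho> N1"] N0 N1 by simp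
  have "1 \<le> r ^ ?d" using r by simp
  then have "Suc ?p \<le> r ^ ?d * tsize (Ite M N0 N1) + ?S" by (simp add: distrib_left)
  from candidate_mono[OF cand * this] show ?case by simp
qed

text \<open>Soundness with \<open>r = tsize M\<close>: the empty context weighs nothing, and
  \<open>r ^ d * tsize M\<close> is the stated power.\<close>

lemma bnd_program:
  assumes "M \<in> programs d"
  shows "bnd (tsize M ^ (d + 1)) M"
proof -
  have "sta d Map.empty M (Lin TBool)" using assms by (simp add: programs_def)
  from sem_if_sta[OF this, of "tsize M" "\<lambda>_. bnd" Var "\<lambda>_. 0"] show ?thesis
    by (simp add: candidate_bnd psubst_Var mult.commute)
qed

section \<open>Sizes of configurations\<close>

lemma fill_bcomp: "fill (bcomp C D) P = fill C (fill D P)"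
  by (induction C) auto

lemma tsize_fill: "tsize (fill C P) + 1 = bsize C + tsize P"
  by (induction C) (auto simp: bsize_def tsize_apps)

lemma bsize_bcomp: "bsize (bcomp C D) + 1 = bsize C + bsize D"
  using tsize_fill[of C "fill D (Var 0)"] by (simp add: bsize_def fill_bcomp)

text \<open>The weight \<open>p\<close> shrinks along a computation while \<open>w\<close> stays at
  a fixed upper bound, so all evaluated terms obey one uniform bound.\<close>

lemma tsize_le_if_bnd:
  assumes "bnd p (psubst \<rho> T)" "p \<le> w" "spine_le n T"
  shows "tsize T \<le> n * (1 + w)"
proof -
  have "nargs T \<le> w"
    using nargs_le_psubst[of T \<rho>] bnd_nargs[OF assms(1)] assms(2) by linarith
  then have "n * (1 + nargs T) \<le> n * (1 + w)" by simp
  with tsize_le_if_spine_le[OF assms(3)] show ?thesis by linarith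
qed

text \<open>The guard moves out of the conditional and only the remainder is added to the
  context.\<close>

lemma bsize_bcomp_CIf_le:
  "bsize (bcomp C (CIf Hole N0 N1 Vs)) \<le> bsize C + tsize (apps (Ite M N0 N1) Vs)"
  using bsize_bcomp[of C "CIf Hole N0 N1 Vs"] by (simp add: bsize_def tsize_apps)

text \<open>The environment \<open>\<rho>\<close> is the unfolding of the m-context, so \<open>psubst \<rho> N\<close> is the term that the
  configuration represents; rule \<open>h\<close> leaves it unchanged.\<close>

lemma csize_le_if_computation:
  assumes "computation C \<A> T b \<Phi>" "bnd p (psubst \<rho> T)" "p \<le> w"
    and "\<forall>y. lc 0 (\<rho> y)" "lc 0 T" "spine_le n T"
    and "\<forall>(x, N)\<in>set \<A>. \<rho> x = psubst \<rho> N \<and> lc 0 N \<and> tsize N \<le> n"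
    and "Config C' \<A>' T' b' \<in> \<Phi>"
  shows "bsize C' + msize \<A>' + tsize T' \<le> bsize C + msize \<A> + n * (1 + w) * (1 + p)"
  using assms
\<comment> \<open>The last summand of the bound is a potential: each \<open>\<beta>\<close>- or
  conditional step lowers \<open>p\<close> by one and releases \<open>n * (1 + w)\<close> for the
  growth of \<open>C\<close> or \<open>\<A>\<close>. The share left at \<open>p = 0\<close> covers
  the evaluated term.\<close>
proof (induction arbitrary: p \<rho> rule: computation.induct)
  case (Ax C \<A> b)
  have "1 \<le> n" using Ax by simp
  then have "1 \<le> n * (1 + w) * (1 + p)" by simp
  then show ?case using Ax by simp
next
  case (beta C \<A> x' N M Vs b \<Phi>)
  let ?T = "apps (App (Lam M) N) Vs"
  have fresh: "x' \<notin> mnames \<A>" "x' \<notin> fv M" "x' \<notin> fv N" "\<And>V. V \<in> set Vs \<Longrightarrow> x' \<notin> fv V"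
    using beta.hyps(2) by (auto simp: fv_apps)
  have sizes: "tsize M + 1 \<le> n" "tsize N \<le> n" "\<forall>V\<in>set Vs. tsize V \<le> n"
    using beta.prems(5) by (auto simp: spine_le_apps)
  have lcs: "lc (Suc 0) M" "lc 0 N" "\<forall>V\<in>set Vs. lc 0 V"
    using beta.prems(4) by (auto simp: lc_apps)
  have T: "tsize ?T \<le> n * (1 + w)"
    using tsize_le_if_bnd[OF beta.prems(1,2,5)] .
  have "bnd p (apps (Lam (psubst \<rho> M)) (psubst \<rho> N # map (psubst \<rho>) Vs))"
    using beta.prems(1) by (simp add: psubst_apps)
  then obtain p' where p': "p = Suc p'"
      "bnd p' (apps (inst 0 (psubst \<rho> N) (psubst \<rho> M)) (map (psubst \<rho>) Vs))"
    using bnd_beta by blast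
  let ?\<rho> = "\<rho>(x' := psubst \<rho> N)"
  have same: "psubst ?\<rho> P = psubst \<rho> P" if "x' \<notin> fv P" for P
    using that by (intro psubst_cong) auto
  have Vs: "map (psubst ?\<rho>) Vs = map (psubst \<rho>) Vs"
    using fresh(4) same by simp
  have bnd': "bnd p' (psubst ?\<rho> (apps (open_at 0 x' M) Vs))"
    unfolding psubst_apps Vs inst_psubst_open_at[OF fresh(2) beta.prems(3), symmetric]
    by (rule p'(2))
  show ?case
  proof (cases "Config C' \<A>' T' b' \<in> \<Phi>")
    case True
    have "bsize C' + msize \<A>' + tsize T'
        \<le> bsize C + msize (\<A> @ [(x', N)]) + n * (1 + w) * (1 + p')"
    proof (rule beta.IH[OF bnd'])
      show "p' \<le> w" using p' beta.prems(2) by simp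
      show "\<forall>y. lc 0 (?\<rho> y)" using beta.prems(3) lcs(2) by (simp add: lc_psubst)
      show "lc 0 (apps (open_at 0 x' M) Vs)" using lcs by (simp add: lc_apps lc_open_at)
      show "spine_le n (apps (open_at 0 x' M) Vs)"
        using sizes by (simp add: spine_le_apps spine_le_if_tsize_le tsize_open_at)
      show "\<forall>(x, P)\<in>set (\<A> @ [(x', N)]). ?\<rho> x = psubst ?\<rho> P \<and> lc 0 P \<and> tsize P \<le> n"
      proof -
        \<comment> \<open>Older assignments keep their unfolding, since the fresh name occurs in
          none of them.\<close>
        have "?\<rho> x = psubst ?\<rho> P" if "(x, P) \<in> set \<A>" for x P
        proof -
          have "x \<noteq> x'" "x' \<notin> fv P" using that fresh(1) by (auto simp: mnames_def)
          with that beta.prems(6) same show ?thesis by auto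
        qed
        with beta.prems(6) lcs sizes same[OF fresh(3)] show ?thesis by auto
      qed
    qed fact
    moreover have "msize (\<A> @ [(x', N)]) \<le> msize \<A> + n * (1 + w)"
    proof -
      \<comment> \<open>A step is being made, so \<open>w\<close> is at least 1 and
        \<open>n * (1 + w)\<close> has room for an assignment of size up to
        \<open>n + 1\<close>.\<close>
      have "n * 1 \<le> n * w" using p' beta.prems(2) by (intro mult_le_mono2) simp
      moreover have "1 \<le> n" using sizes(1) by simp
      ultimately have "n + 1 \<le> n * (1 + w)" by simp
      with sizes(2) have "tsize N + 1 \<le> n * (1 + w)" by linarith
      then show ?thesis by (simp add: msize_def)
    qed
    ultimately show ?thesis using p'(1) by simp
  next
    case False
    then have "C' = C" "\<A>' = \<A>" "T' = ?T" using beta.prems(7) by auto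
    then show ?thesis using T by simp
  qed
next
  case (h C \<A> N Vs b \<Phi> x)
  let ?T = "apps (Var x) Vs"
  have N: "\<rho> x = psubst \<rho> N" "lc 0 N" "tsize N \<le> n" using h.prems(6) h.hyps(2) by auto
  have T: "tsize ?T \<le> n * (1 + w)"
    using tsize_le_if_bnd[OF h.prems(1,2,5)] .
  show ?case
  proof (cases "Config C' \<A>' T' b' \<in> \<Phi>")
    case True
    show ?thesis
    proof (rule h.IH[where \<rho> = \<rho>])
      show "bnd p (psubst \<rho> (apps N Vs))" using h.prems(1) N by (simp add: psubst_apps)
      show "lc 0 (apps N Vs)" using h.prems(4) N by (simp add: lc_apps)
      \<comment> \<open>The looked-up term may be as large as \<open>n\<close>, but head and
        arguments are measured separately.\<close>
      show "spine_le n (apps N Vs)"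
        using h.prems(5) N by (simp add: spine_le_apps spine_le_if_tsize_le)
    qed (use True h.prems in auto)
  next
    case False
    then have "C' = C" "\<A>' = \<A>" "T' = ?T" using h.prems(7) by auto
    then show ?thesis using T by simp
  qed
next
  case (if0 C N0 N1 Vs \<A> M \<Phi> b \<Psi>)
  let ?T = "apps (Ite M N0 N1) Vs"
  have T: "tsize ?T \<le> n * (1 + w)"
    using tsize_le_if_bnd[OF if0.prems(1,2,5)] .
  have lcs: "lc 0 M" "lc 0 N0" "\<forall>V\<in>set Vs. lc 0 V"
    using if0.prems(4) by (auto simp: lc_apps)
  have sizes: "tsize M \<le> n" "tsize N0 \<le> n" "\<forall>V\<in>set Vs. tsize V \<le> n"
    using if0.prems(5) by (auto simp: spine_le_apps)
  \<comment> \<open>\<open>bnd\<close> controls both branches, so the value of the guard need not be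
    known.\<close>
  obtain p' where p': "p = Suc p'" "bnd p' (psubst \<rho> M)" "bnd p' (psubst \<rho> (apps N0 Vs))"
    using if0.prems(1) bnd_Ite[of p "psubst \<rho> M" "psubst \<rho> N0" "psubst \<rho> N1" "map (psubst \<rho>) Vs"]
    by (auto simp: psubst_apps)
  consider "Config C' \<A>' T' b' \<in> \<Phi>" | "Config C' \<A>' T' b' \<in> \<Psi>" | "C' = C" "\<A>' = \<A>" "T' = ?T"
    using if0.prems(7) by auto
  then show ?case
  proof cases
    case 1
    have "bsize C' + msize \<A>' + tsize T'
        \<le> bsize (bcomp C (CIf Hole N0 N1 Vs)) + msize \<A> + n * (1 + w) * (1 + p')"
      by (rule if0.IH(1)[OF p'(2)])
        (use 1 p'(1) lcs sizes if0.prems in \<open>auto simp: spine_le_if_tsize_le\<close>)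
    with T p'(1) bsize_bcomp_CIf_le[of C N0 N1 Vs M] show ?thesis by simp
  next
    case 2
    \<comment> \<open>The branch starts again from \<open>C\<close> and \<open>\<A>\<close>:
      assignments made while evaluating the guard are gone.\<close>
    have "bsize C' + msize \<A>' + tsize T' \<le> bsize C + msize \<A> + n * (1 + w) * (1 + p')"
      by (rule if0.IH(2)[OF p'(3)])
        (use 2 p'(1) lcs sizes if0.prems in
          \<open>auto simp: lc_apps spine_le_apps spine_le_if_tsize_le\<close>)
    with p'(1) show ?thesis by simp
  next
    case 3
    with T show ?thesis by simp
  qed
next
  case (if1 C N0 N1 Vs \<A> M \<Phi> b \<Psi>)
  let ?T = "apps (Ite M N0 N1) Vs"
  have T: "tsize ?T \<le> n * (1 + w)"
    using tsize_le_if_bnd[OF if1.prems(1,2,5)] .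
  have lcs: "lc 0 M" "lc 0 N1" "\<forall>V\<in>set Vs. lc 0 V"
    using if1.prems(4) by (auto simp: lc_apps)
  have sizes: "tsize M \<le> n" "tsize N1 \<le> n" "\<forall>V\<in>set Vs. tsize V \<le> n"
    using if1.prems(5) by (auto simp: spine_le_apps)
  obtain p' where p': "p = Suc p'" "bnd p' (psubst \<rho> M)" "bnd p' (psubst \<rho> (apps N1 Vs))"
    using if1.prems(1) bnd_Ite[of p "psubst \<rho> M" "psubst \<rho> N0" "psubst \<rho> N1" "map (psubst \<rho>) Vs"]
    by (auto simp: psubst_apps)
  consider "Config C' \<A>' T' b' \<in> \<Phi>" | "Config C' \<A>' T' b' \<in> \<Psi>" | "C' = C" "\<A>' = \<A>" "T' = ?T"
    using if1.prems(7) by auto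
  then show ?case
  proof cases
    case 1
    have "bsize C' + msize \<A>' + tsize T'
        \<le> bsize (bcomp C (CIf Hole N0 N1 Vs)) + msize \<A> + n * (1 + w) * (1 + p')"
      by (rule if1.IH(1)[OF p'(2)])
        (use 1 p'(1) lcs sizes if1.prems in \<open>auto simp: spine_le_if_tsize_le\<close>)
    with T p'(1) bsize_bcomp_CIf_le[of C N0 N1 Vs M] show ?thesis by simp
  next
    case 2
    have "bsize C' + msize \<A>' + tsize T' \<le> bsize C + msize \<A> + n * (1 + w) * (1 + p')"
      by (rule if1.IH(2)[OF p'(3)])
        (use 2 p'(1) lcs sizes if1.prems in
          \<open>auto simp: lc_apps spine_le_apps spine_le_if_tsize_le\<close>)
    with p'(1) show ?thesis by simp
  next
    case 3
    with T show ?thesis by simp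
  qed
qed

theorem theorem4:
  fixes d :: nat and M :: trm
  assumes "M \<in> programs d"
  shows "space M \<le> enat (6 * tsize M ^ (3 * d + 3))"
proof -
  let ?n = "tsize M" and ?w = "tsize M ^ (d + 1)"
  have n: "1 \<le> ?n" by (rule tsize_pos)
  have lcM: "lc 0 M" using assms lc_if_sta by (auto simp: programs_def)
  have bound: "1 + ?n * (1 + ?w) * (1 + ?w) \<le> 6 * ?n ^ (3 * d + 3)"
  proof -
    have w: "1 \<le> ?w" using n by simp
    \<comment> \<open>Each factor \<open>1 + ?w\<close> is at most \<open>2 * ?w\<close>, giving the
      coefficient 4 and the exponent \<open>1 + 2 * (d + 1)\<close>.\<close>
    have "?n * (1 + ?w) * (1 + ?w) \<le> ?n * (2 * ?w) * (2 * ?w)"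
      using w by (intro mult_le_mono) auto
    also have "\<dots> = 4 * ?n ^ (2 * d + 3)"
      by (simp add: power_add power_mult power2_eq_square power3_eq_cube algebra_simps)
    also have "\<dots> \<le> 4 * ?n ^ (3 * d + 3)"
      using n by (intro mult_le_mono power_increasing) auto
    finally have "?n * (1 + ?w) * (1 + ?w) \<le> 4 * ?n ^ (3 * d + 3)" .
    moreover have "1 \<le> ?n ^ (3 * d + 3)" using n by simp
    ultimately show ?thesis by linarith
  qed
  have "csize \<phi> \<le> 6 * ?n ^ (3 * d + 3)" if "computation Hole [] M b \<Phi>" "\<phi> \<in> \<Phi>" for \<phi> b \<Phi>
  proof (cases \<phi>)
    case (Config C' \<A>' T' b')
    \<comment> \<open>The m-context is empty at the start, so the identity environment
      \<open>Var\<close> serves, and \<open>p\<close> and \<open>w\<close> are both the initial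
      weight.\<close>
    have "bsize C' + msize \<A>' + tsize T' \<le> bsize Hole + msize [] + ?n * (1 + ?w) * (1 + ?w)"
      using that Config lcM bnd_program[OF assms]
      by (intro csize_le_if_computation[where \<rho> = Var]) (auto simp: psubst_Var spine_le_if_tsize_le)
    also have "bsize Hole + msize [] = 1" by (simp add: bsize_def msize_def)
    finally show ?thesis using bound Config by simp
  qed
  then show ?thesis unfolding space_def by (intro SUP_least) auto
qed

end
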